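(* Let $\mu>0$ and let $x^*$ be an optimal solution to the problem $\min_{x\in\mathbb{R}^n}F_1(x):=f(x)+\mu\|x\|_1$. Suppose that $\nabla f$ is differentiable at $x^*$. Define $\mathcal{E}:=\{j\in\{1,\ldots,n\}: |(\nabla f(x^* ))_j|=\mu\}$, $K:=\{j\in\mathcal{E}: x^*_j=0\}$, $\mathcal{U}:=\{u\in\mathbb{R}^{\mathcal{E}}: u_j(\nabla f(x^* ))_j\le 0,\ j\in K\}$, and $\mathcal{H}_{\mathcal{E}}(x^* ):=[\nabla^2f(x^* )_{i,j}]_{i,j\in\mathcal{E}}$. Then the following statements are equivalent: (i) The subdifferential mapping $\partial F_1$ is strongly metrically subregular at $x^*$ for $0$. (ii) $\mathcal{H}_{\mathcal{E}}(x^* )$ is positive definite over $\mathcal{U}$ in the sense that $\langle\mathcal{H}_{\mathcal{E}}(x^* )u,u\rangle>0$ for all $u\in\mathcal{U}\setminus\{0\}$. (iii) $\mathcal{H}_{\mathcal{E}}(x^* )$ is nonsingular over $\mathcal{U}$ in the sense that $\ker\mathcal{H}_{\mathcal{E}}(x^* )\cap\mathcal{U}=\{0\}$. Moreover, if (ii) is satisfied, then $\partial F_1$ is strongly metrically subregular at $x^*$ for $0$ with any modulus $\kappa>c^{-1}$, where $$c:=\min\left\{\frac{\langle\mathcal{H}_{\mathcal{E}}(x^* )u,u\rangle}{\|u\|^2}\,\Big|\; u\in\mathcal{U}\right\}$$ with the convention $\frac{0}{0}=\infty$.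
   Context: Standing assumptions, with $g:=\mu\|\cdot\|_1$ and $F_1=f+g$: $f:\mathbb{R}^n\to\mathbb{R}\cup\{+\infty\}$ is proper, lower semicontinuous and convex with $\mathrm{int}(\mathrm{dom}\, f)\neq\emptyset$; and for any $x\in\mathrm{int}(\mathrm{dom}\, f)$ the sublevel set $\{F_1\le F_1(x)\}$ is contained in $\mathrm{int}(\mathrm{dom}\, f)$ and $f$ is continuously differentiable at any point of this sublevel set. $\partial$ is the convex subdifferential. A set-valued mapping $G:\mathbb{R}^n\rightrightarrows\mathbb{R}^n$ is metrically subregular at $\bar x$ for $\bar y\in G(\bar x)$ with modulus $\kappa>0$ if there is a neighborhood $U$ of $\bar x$ with $d(x;G^{-1}(\bar y))\le\kappa\, d(\bar y;G(x))$ for all $x\in U$ ($d$ the distance, $d(x;\emptyset)=\infty$). It is strongly metrically subregular at $\bar x$ for $\bar y$ (with modulus $\kappa$) if in addition $\bar x$ is an isolated point of $G^{-1}(\bar y)$. *)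

theory Defs
  imports "HOL-Analysis.Analysis"
begin

section \<open>Convex analysis of extended-real-valued functions\<close>

definition edom :: "('a \<Rightarrow> ereal) \<Rightarrow> 'a set" where
  "edom f = {x. f x < \<infinity>}"

definition proper :: "('a \<Rightarrow> ereal) \<Rightarrow> bool" where
  "proper f \<longleftrightarrow> (\<forall>x. f x \<noteq> -\<infinity>) \<and> edom f \<noteq> {}"

definition lower_semicontinuous :: "('a::topological_space \<Rightarrow> ereal) \<Rightarrow> bool" where
  "lower_semicontinuous f \<longleftrightarrow> (\<forall>x. f x \<le> Liminf (at x) f)"

text \<open>The library's \<^const>\<open>convex_on\<close> only covers real-valued functions. The endpoints of the
  unit interval are left out so that no product of \<open>0\<close> and \<open>\<infinity>\<close> occurs.\<close>

definition econvex :: "('a::real_vector \<Rightarrow> ereal) \<Rightarrow> bool" where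
  "econvex f \<longleftrightarrow> (\<forall>x y t. 0 < t \<and> t < 1 \<longrightarrow>
     f ((1 - t) *\<^sub>R x + t *\<^sub>R y) \<le> ereal (1 - t) * f x + ereal t * f y)"

definition subdifferential :: "('a::real_inner \<Rightarrow> ereal) \<Rightarrow> 'a \<Rightarrow> 'a set" where
  "subdifferential f x = {v. x \<in> edom f \<and> (\<forall>y. f x + ereal (v \<bullet> (y - x)) \<le> f y)}"

section \<open>Gradient and Hessian\<close>

text \<open>Derivatives are taken of \<^term>\<open>\<lambda>y. real_of_ereal (f y)\<close>. As \<^const>\<open>real_of_ereal\<close> sends \<open>\<infinity>\<close> to \<open>0\<close>,
  this is meaningful only in the interior of the domain.\<close>

definition differentiable_at :: "('a::real_inner \<Rightarrow> ereal) \<Rightarrow> 'a \<Rightarrow> bool" where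
  "differentiable_at f x \<longleftrightarrow>
     x \<in> interior (edom f) \<and> (\<exists>D. GDERIV (\<lambda>y. real_of_ereal (f y)) x :> D)"

definition gradient :: "('a::real_inner \<Rightarrow> ereal) \<Rightarrow> 'a \<Rightarrow> 'a" where
  "gradient f x = (THE D. GDERIV (\<lambda>y. real_of_ereal (f y)) x :> D)"

definition continuously_differentiable_at :: "('a::real_inner \<Rightarrow> ereal) \<Rightarrow> 'a \<Rightarrow> bool" where
  "continuously_differentiable_at f x \<longleftrightarrow>
     (\<forall>\<^sub>F y in nhds x. differentiable_at f y) \<and> isCont (gradient f) x"

definition hessian :: "(real ^ 'n \<Rightarrow> ereal) \<Rightarrow> real ^ 'n \<Rightarrow> real ^ 'n ^ 'n" where
  "hessian f x = jacobian (gradient f) (at x)"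

section \<open>Metric subregularity\<close>

text \<open>The infimum is taken in \<^typ>\<open>ereal\<close>, so the distance to the empty set is \<open>\<infinity>\<close>
  (unlike for \<^const>\<open>infdist\<close>).\<close>

definition edist_set :: "'a::metric_space \<Rightarrow> 'a set \<Rightarrow> ereal" where
  "edist_set x A = (INF a\<in>A. ereal (dist x a))"

definition preimage_at :: "('a \<Rightarrow> 'b set) \<Rightarrow> 'b \<Rightarrow> 'a set" where
  "preimage_at G y = {x. y \<in> G x}"

definition metrically_subregular_with ::
  "('a::metric_space \<Rightarrow> 'b::metric_space set) \<Rightarrow> 'a \<Rightarrow> 'b \<Rightarrow> real \<Rightarrow> bool" where
  "metrically_subregular_with G xbar ybar \<kappa> \<longleftrightarrow> \<kappa> > 0 \<and> ybar \<in> G xbar \<and>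
     (\<exists>U. open U \<and> xbar \<in> U \<and>
        (\<forall>x\<in>U. edist_set x (preimage_at G ybar) \<le> ereal \<kappa> * edist_set ybar (G x)))"

definition strongly_metrically_subregular_with ::
  "('a::metric_space \<Rightarrow> 'b::metric_space set) \<Rightarrow> 'a \<Rightarrow> 'b \<Rightarrow> real \<Rightarrow> bool" where
  "strongly_metrically_subregular_with G xbar ybar \<kappa> \<longleftrightarrow>
     metrically_subregular_with G xbar ybar \<kappa> \<and> xbar isolated_in preimage_at G ybar"

definition strongly_metrically_subregular ::
  "('a::metric_space \<Rightarrow> 'b::metric_space set) \<Rightarrow> 'a \<Rightarrow> 'b \<Rightarrow> bool" where
  "strongly_metrically_subregular G xbar ybar \<longleftrightarrow>
     (\<exists>\<kappa>. strongly_metrically_subregular_with G xbar ybar \<kappa>)"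

section \<open>The l1-regularized problem\<close>

definition l1_norm :: "real ^ 'n \<Rightarrow> real" where
  "l1_norm x = (\<Sum>j\<in>UNIV. \<bar>x $ j\<bar>)"

definition F1 :: "(real ^ 'n \<Rightarrow> ereal) \<Rightarrow> real \<Rightarrow> real ^ 'n \<Rightarrow> ereal" where
  "F1 f \<mu> x = f x + ereal (\<mu> * l1_norm x)"

definition E_set :: "(real ^ 'n \<Rightarrow> ereal) \<Rightarrow> real \<Rightarrow> real ^ 'n \<Rightarrow> 'n set" where
  "E_set f \<mu> x = {j. \<bar>gradient f x $ j\<bar> = \<mu>}"

definition K_set :: "(real ^ 'n \<Rightarrow> ereal) \<Rightarrow> real \<Rightarrow> real ^ 'n \<Rightarrow> 'n set" where
  "K_set f \<mu> x = {j \<in> E_set f \<mu> x. x $ j = 0}"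

text \<open>For a set \<open>E\<close> of indices, \<open>\<real>\<^sup>E\<close> is represented by the vectors of \<open>\<real>\<^sup>n\<close> supported in \<open>E\<close>, which
  have the same inner product and norm. A square matrix indexed by \<open>E\<close> is accordingly extended by
  zero; on vectors supported in \<open>E\<close> the product \<^const>\<open>matrix_vector_mult\<close> is then that of
  the \<open>E\<close>-indexed matrix and vector.\<close>

definition coord_space :: "'n set \<Rightarrow> (real ^ 'n) set" where
  "coord_space E = {u. \<forall>j. j \<notin> E \<longrightarrow> u $ j = 0}"

definition principal_submatrix :: "'n set \<Rightarrow> real ^ 'n ^ 'n \<Rightarrow> real ^ 'n ^ 'n" where
  "principal_submatrix E A = (\<chi> i j. if i \<in> E \<and> j \<in> E then A $ i $ j else 0)"

definition kernel_in :: "'n set \<Rightarrow> real ^ 'n ^ 'n \<Rightarrow> (real ^ 'n) set" where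
  "kernel_in E A = {u \<in> coord_space E. A *v u = 0}"

definition U_set :: "(real ^ 'n \<Rightarrow> ereal) \<Rightarrow> real \<Rightarrow> real ^ 'n \<Rightarrow> (real ^ 'n) set" where
  "U_set f \<mu> x =
     {u \<in> coord_space (E_set f \<mu> x). \<forall>j\<in>K_set f \<mu> x. u $ j * gradient f x $ j \<le> 0}"

definition H_E :: "(real ^ 'n \<Rightarrow> ereal) \<Rightarrow> real \<Rightarrow> real ^ 'n \<Rightarrow> real ^ 'n ^ 'n" where
  "H_E f \<mu> x = principal_submatrix (E_set f \<mu> x) (hessian f x)"

text \<open>The convention \<open>0/0 = \<infinity>\<close> has to be built in, since division by zero yields \<open>0\<close> in HOL.\<close>

definition rayleigh_quotient :: "real ^ 'n ^ 'n \<Rightarrow> real ^ 'n \<Rightarrow> ereal" where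
  "rayleigh_quotient A u = (if u = 0 then \<infinity> else ereal (((A *v u) \<bullet> u) / (norm u)\<^sup>2))"

definition c_const :: "(real ^ 'n \<Rightarrow> ereal) \<Rightarrow> real \<Rightarrow> real ^ 'n \<Rightarrow> ereal" where
  "c_const f \<mu> x = (INF u\<in>U_set f \<mu> x. rayleigh_quotient (H_E f \<mu> x) u)"

end

theory Submission
  imports Defs
begin

text \<open>Write \<open>g = \<nabla>f\<close>, \<open>x*\<close> for the minimizer, \<open>H\<close> for the Hessian at \<open>x*\<close> and \<open>h = x - x*\<close>.
  Near \<open>x*\<close> the function \<open>f\<close> is differentiable, so \<open>v\<close> is a subgradient of \<open>F\<^sub>1\<close> at \<open>x\<close> exactly
  if \<open>w = v - g x\<close> is a subgradient of \<open>\<mu>\<parallel>\<cdot>\<parallel>\<^sub>1\<close> at \<open>x\<close>. This is a condition on each coordinate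
  separately: \<open>\<bar>w\<^sub>j\<bar> \<le> \<mu>\<close> and \<open>w\<^sub>j x\<^sub>j = \<mu>\<bar>x\<^sub>j\<bar>\<close> (\<open>subdifferential_F1_iff\<close>). At \<open>x*\<close> with \<open>v = 0\<close>
  it says that \<open>- g x*\<close> is a subgradient of \<open>\<mu>\<parallel>\<cdot>\<parallel>\<^sub>1\<close>. Moreover, strong subregularity
  with modulus \<open>\<kappa>\<close> amounts to the error bound \<open>\<parallel>h\<parallel> \<le> \<kappa>\<parallel>v\<parallel>\<close> for all \<open>x\<close> near \<open>x*\<close> and all
  subgradients \<open>v\<close> at \<open>x\<close> (\<open>strongly_metrically_subregular_with_iff\<close>).

  Positivity gives the error bound. If \<open>x\<close> is close to \<open>x*\<close> and \<open>v\<close> is small, then \<open>w\<close> is close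
  to \<open>- g x*\<close>. The coordinatewise description then forces \<open>h \<in> \<U>\<close> (\<open>displacement_in_U\<close>):
  \<open>x\<^sub>j\<close> vanishes where \<open>\<bar>w\<^sub>j\<bar> < \<mu>\<close>, and on \<open>\<E>\<close> a nonzero \<open>x\<^sub>j\<close> has the sign of
  \<open>w\<^sub>j\<close>, hence of \<open>- (g x*)\<^sub>j\<close>.
  As the subdifferential of \<open>\<mu>\<parallel>\<cdot>\<parallel>\<^sub>1\<close> is monotone,
  \<open>v \<bullet> h \<ge> (g x - g x*) \<bullet> h = Hh \<bullet> h + o(\<parallel>h\<parallel>\<^sup>2) \<ge> (c - o(1))\<parallel>h\<parallel>\<^sup>2\<close>,
  and therefore \<open>\<parallel>v\<parallel> \<ge> c'\<parallel>h\<parallel>\<close> near \<open>x*\<close> for each \<open>c' < c\<close> (\<open>subgradient_lower_bound\<close>). This yields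
  every modulus \<open>\<kappa> > 1/c\<close>. The constant \<open>c\<close> is attained, hence positive, because \<open>\<U>\<close> is a closed cone.

  The error bound gives nonsingularity. For \<open>u \<in> \<U>\<close> with \<open>H\<^sub>\<E> u = 0\<close>, keep the \<open>l\<^sub>1\<close> part of the
  subgradient equal to \<open>- g x*\<close> on \<open>\<E>\<close> and let it cancel \<open>g\<close> off \<open>\<E>\<close>. This gives a subgradient at
  \<open>x* + tu\<close> that is the restriction of \<open>g (x* + tu) - g x*\<close> to \<open>\<E>\<close>. Its norm is \<open>o(t)\<close>, and the error
  bound forces \<open>u = 0\<close> (\<open>no_error_bound_along_kernel\<close>).

  Nonsingularity gives positivity by way of convexity: the gradient of a convex function is
  cyclically monotone, and the cycle \<open>x*\<close>, \<open>x* + tu\<close>, \<open>x* + tw\<close> gives in the limit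
  \<open>Hu \<bullet> w \<le> Hu \<bullet> u + Hw \<bullet> w\<close> (\<open>hessian_cyclic_bound\<close>). If \<open>Hu \<bullet> u \<le> 0\<close>, then replacing \<open>w\<close> by
  small multiples of \<open>Hu\<close> yields \<open>Hu = 0\<close> (\<open>hessian_kernel\<close>).\<close>

section \<open>Directional limits\<close>

lemma eventually_along_ray:
  fixes x d :: "'a::real_normed_vector"
  assumes "\<forall>\<^sub>F z in nhds x. P z"
  shows "\<forall>\<^sub>F t in at_right 0. P (x + t *\<^sub>R d)"
proof -
  have "((\<lambda>t. x + t *\<^sub>R d) \<longlongrightarrow> x + 0 *\<^sub>R d) (at_right 0)"
    by (intro tendsto_intros)
  then have "((\<lambda>t. x + t *\<^sub>R d) \<longlongrightarrow> x) (at_right 0)" by simp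
  then show ?thesis by (rule eventually_compose_filterlim[OF assms])
qed

lemma has_derivative_directional_limit:
  fixes G :: "'a::real_normed_vector \<Rightarrow> 'b::real_normed_vector"
  assumes "(G has_derivative G') (at x)"
  shows "((\<lambda>t. (G (x + t *\<^sub>R d) - G x) /\<^sub>R t) \<longlongrightarrow> G' d) (at_right 0)"
proof -
  have l: "linear G'" using assms has_derivative_linear by blast
  have "((\<lambda>t. x + t *\<^sub>R d) has_derivative (\<lambda>t. t *\<^sub>R d)) (at 0)"
    by (auto intro!: derivative_eq_intros)
  then have "((\<lambda>t. G (x + t *\<^sub>R d)) has_derivative (\<lambda>t. G' (t *\<^sub>R d))) (at 0)"
    using has_derivative_compose[of "\<lambda>t. x + t *\<^sub>R d" _ 0 UNIV G G'] assms by simp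
  then have "((\<lambda>t. G (x + t *\<^sub>R d)) has_derivative (\<lambda>t. G' (t *\<^sub>R d))) (at_right 0)"
    by (rule has_derivative_at_withinI)
  then have "((\<lambda>t. (1 / (norm t)) *\<^sub>R (G (x + t *\<^sub>R d) - (G x + t *\<^sub>R G' d))) \<longlongrightarrow> 0) (at_right 0)"
    unfolding has_derivative_within by (simp add: linear_scale[OF l])
  then have "((\<lambda>t. (G (x + t *\<^sub>R d) - G x) /\<^sub>R t - G' d) \<longlongrightarrow> 0) (at_right 0)"
    by (rule Lim_transform_eventually)
       (auto intro!: eventually_at_rightI[of 0 1] simp: algebra_simps divide_inverse)
  then show ?thesis by (simp add: LIM_zero_iff)
qed

text \<open>Transfers a bound on difference quotients to the derivative. Only small \<open>t\<close> are considered, since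
  the real part of an extended-valued function is meaningful only near an interior point of the domain.\<close>

lemma slope_le_if_quotient_le:
  fixes \<phi> :: "'a::real_inner \<Rightarrow> real"
  assumes "GDERIV \<phi> x :> D"
    and "\<forall>\<^sub>F t in at_right 0. \<phi> (x + t *\<^sub>R d) - \<phi> x \<le> t * C"
  shows "D \<bullet> d \<le> C"
proof -
  have "((\<lambda>t. (\<phi> (x + t *\<^sub>R d) - \<phi> x) /\<^sub>R t) \<longlongrightarrow> d \<bullet> D) (at_right 0)"
    using has_derivative_directional_limit assms(1)[unfolded gderiv_def] by blast
  moreover have "eventually (\<lambda>t. (\<phi> (x + t *\<^sub>R d) - \<phi> x) /\<^sub>R t \<le> C) (at_right (0::real))"
    using assms(2) eventually_at_right_less[of "0::real"]
    by eventually_elim (simp add: field_simps)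
  ultimately have "d \<bullet> D \<le> C"
    by (intro tendsto_upperbound) auto
  then show ?thesis by (simp add: inner_commute)
qed

section \<open>Gradients of convex functions\<close>

lemma gradient_GDERIV:
  assumes "differentiable_at f x"
  shows "GDERIV (\<lambda>y. real_of_ereal (f y)) x :> gradient f x"
proof -
  obtain D where D: "GDERIV (\<lambda>y. real_of_ereal (f y)) x :> D"
    using assms unfolding differentiable_at_def by blast
  have "D' = D" if "GDERIV (\<lambda>y. real_of_ereal (f y)) x :> D'" for D'
    using has_derivative_unique[OF D[unfolded gderiv_def] that[unfolded gderiv_def]]
    by (metis (mono_tags) inner_commute vector_eq_ldot)
  then show ?thesis unfolding gradient_def using D by (rule theI[of _ D, rotated])
qed

lemma proper_finite:
  assumes "proper f" "x \<in> edom f"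
  shows "f x = ereal (real_of_ereal (f x))"
  using assms unfolding proper_def edom_def by (cases "f x") auto

lemma differentiable_at_in_edom:
  "differentiable_at f x \<Longrightarrow> x \<in> edom f"
  using interior_subset unfolding differentiable_at_def by blast

lemma gradient_inequality:
  assumes "proper f" "econvex f" "differentiable_at f x"
  shows "f x + ereal (gradient f x \<bullet> (y - x)) \<le> f y"
proof (cases "y \<in> edom f")
  case False
  then show ?thesis by (simp add: edom_def)
next
  case True
  let ?r = "\<lambda>y. real_of_ereal (f y)"
  have x: "x \<in> edom f" using assms(3) by (rule differentiable_at_in_edom)
  have "gradient f x \<bullet> (y - x) \<le> ?r y - ?r x"
  proof (rule slope_le_if_quotient_le[OF gradient_GDERIV[OF assms(3)]],
      rule eventually_at_rightI[of 0 1])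
    fix t :: real assume "t \<in> {0<..<1}"
    then have t: "0 < t" "t < 1" by auto
    let ?z = "x + t *\<^sub>R (y - x)"
    have "?z = (1 - t) *\<^sub>R x + t *\<^sub>R y" by (simp add: algebra_simps)
    then have "f ?z \<le> ereal (1 - t) * f x + ereal t * f y"
      using assms(2) t unfolding econvex_def by metis
    then have le: "f ?z \<le> ereal ((1 - t) * ?r x + t * ?r y)"
      using proper_finite[OF assms(1) x] proper_finite[OF assms(1) True]
      by (metis plus_ereal.simps(1) times_ereal.simps(1))
    then have "?z \<in> edom f" unfolding edom_def using le_less_trans by fastforce
    then have "ereal (?r ?z) \<le> ereal ((1 - t) * ?r x + t * ?r y)"
      using le proper_finite[OF assms(1), of ?z] by simp
    then have "?r ?z \<le> (1 - t) * ?r x + t * ?r y" by simp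
    then show "?r ?z - ?r x \<le> t * (?r y - ?r x)" by (simp add: algebra_simps)
  qed simp
  then show ?thesis
    using proper_finite[OF assms(1) x] proper_finite[OF assms(1) True]
    by (cases "f x"; cases "f y") auto
qed

text \<open>Cyclic monotonicity for three points: add the three gradient inequalities around the cycle.
  Cycles of length two (monotonicity) would yield only that the Hessian is positive semidefinite.\<close>

lemma gradient_three_cycle:
  assumes "proper f" "econvex f"
    and "differentiable_at f a" "differentiable_at f b" "differentiable_at f c"
  shows "gradient f a \<bullet> (b - a) + gradient f b \<bullet> (c - b) + gradient f c \<bullet> (a - c) \<le> 0"
proof -
  let ?r = "\<lambda>y. real_of_ereal (f y)"
  have *: "?r x + gradient f x \<bullet> (y - x) \<le> ?r y"
    if d: "differentiable_at f x" "differentiable_at f y" for x y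
  proof -
    have "x \<in> edom f" "y \<in> edom f"
      using d by (auto intro: differentiable_at_in_edom)
    then show ?thesis
      using gradient_inequality[OF assms(1,2) d(1), of y] proper_finite[OF assms(1), of x]
        proper_finite[OF assms(1), of y]
      by (cases "f x"; cases "f y") auto
  qed
  show ?thesis using *[OF assms(3,4)] *[OF assms(4,5)] *[OF assms(5,3)] by linarith
qed

text \<open>Apply three-point cyclic monotonicity to \<open>x\<close>, \<open>x + tu\<close>, \<open>x + tw\<close>, divide by \<open>t\<^sup>2\<close> and let
  \<open>t\<close> tend to \<open>0\<close>.\<close>

lemma hessian_cyclic_bound:
  fixes f :: "'a::real_inner \<Rightarrow> ereal"
  assumes "proper f" "econvex f"
    and ev: "\<forall>\<^sub>F y in nhds x. differentiable_at f y"
    and H: "(gradient f has_derivative H) (at x)"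
  shows "H u \<bullet> w \<le> H u \<bullet> u + H w \<bullet> w"
proof -
  let ?q = "\<lambda>d t. (gradient f (x + t *\<^sub>R d) - gradient f x) /\<^sub>R t"
  have q: "(?q d \<longlongrightarrow> H d) (at_right 0)" for d
    by (rule has_derivative_directional_limit[OF H])
  have "\<forall>\<^sub>F t in at_right 0. ?q u t \<bullet> w \<le> ?q u t \<bullet> u + ?q w t \<bullet> w"
    using eventually_along_ray[OF ev, of u] eventually_along_ray[OF ev, of w] eventually_at_right_less[of "0::real"]
  proof eventually_elim
    case (elim t)
    have "differentiable_at f x" using ev by (rule eventually_nhds_x_imp_x)
    from gradient_three_cycle[OF assms(1,2) this elim(1,2)]
    have "t * (gradient f x \<bullet> u + gradient f (x + t *\<^sub>R u) \<bullet> (w - u) - gradient f (x + t *\<^sub>R w) \<bullet> w) \<le> 0"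
      by (simp add: algebra_simps)
    then have le: "(gradient f (x + t *\<^sub>R u) - gradient f x) \<bullet> w \<le>
          (gradient f (x + t *\<^sub>R u) - gradient f x) \<bullet> u + (gradient f (x + t *\<^sub>R w) - gradient f x) \<bullet> w"
      using elim(3) by (simp add: mult_le_0_iff inner_simps)
    show ?case
      using mult_left_mono[OF le, of "inverse t"] elim(3) by (simp add: distrib_left)
  qed
  then show ?thesis
    by (rule tendsto_le[OF trivial_limit_at_right_real
          tendsto_add[OF tendsto_inner[OF q tendsto_const] tendsto_inner[OF q tendsto_const]]
          tendsto_inner[OF q tendsto_const]])
qed

text \<open>For \<open>w = s Hu\<close> the left side of the bound is linear and the right side at most quadratic in
  \<open>s\<close>, so the linear coefficient \<open>\<parallel>Hu\<parallel>\<^sup>2\<close> cannot be positive. For symmetric positive semidefinite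
  matrices this is the familiar fact that isotropic vectors lie in the kernel.\<close>

lemma hessian_kernel:
  fixes H :: "'a::real_inner \<Rightarrow> 'a"
  assumes "linear H" and bound: "\<And>u w. H u \<bullet> w \<le> H u \<bullet> u + H w \<bullet> w"
    and "H u \<bullet> u \<le> 0"
  shows "H u = 0"
proof -
  have "H u \<bullet> H u \<le> s * (H (H u) \<bullet> H u)" if "s > 0" for s :: real
  proof -
    have "s * (H u \<bullet> H u) \<le> s * (s * (H (H u) \<bullet> H u))"
      using bound[of u "s *\<^sub>R H u"] assms(3) by (simp add: linear_scale[OF assms(1)])
    then show ?thesis using that by simp
  qed
  then have "\<forall>\<^sub>F s in at_right 0. H u \<bullet> H u \<le> s * (H (H u) \<bullet> H u)"
    by (intro eventually_at_rightI[of 0 1]) auto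
  moreover have "((\<lambda>s. s * (H (H u) \<bullet> H u)) \<longlongrightarrow> 0 * (H (H u) \<bullet> H u)) (at_right 0)"
    by (intro tendsto_intros)
  ultimately have "H u \<bullet> H u \<le> 0" by (intro tendsto_lowerbound) auto
  then show ?thesis using inner_eq_zero_iff[of "H u"] inner_ge_zero[of "H u"] by linarith
qed

section \<open>The subdifferential of the regularized function\<close>

lemma l1_norm_segment:
  assumes "0 \<le> t" "t \<le> 1"
  shows "l1_norm (x + t *\<^sub>R d) - l1_norm x \<le> t * (l1_norm (x + d) - l1_norm x)"
proof -
  have "\<bar>a + t * b\<bar> \<le> (1 - t) * \<bar>a\<bar> + t * \<bar>a + b\<bar>" for a b :: real
  proof -
    have "a + t * b = (1 - t) * a + t * (a + b)" by (simp add: algebra_simps)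
    then have "\<bar>a + t * b\<bar> \<le> \<bar>(1 - t) * a\<bar> + \<bar>t * (a + b)\<bar>" by (metis abs_triangle_ineq)
    then show ?thesis using assms by (simp add: abs_mult)
  qed
  then have "l1_norm (x + t *\<^sub>R d) \<le> (\<Sum>j\<in>UNIV. (1 - t) * \<bar>x $ j\<bar> + t * \<bar>x $ j + d $ j\<bar>)"
    unfolding l1_norm_def by (intro sum_mono) simp
  then show ?thesis
    by (simp add: l1_norm_def sum.distrib sum_subtractf sum_distrib_left[symmetric] algebra_simps)
qed

lemma mult_le_abs_bound:
  fixes a y \<mu> :: real
  assumes "\<bar>a\<bar> \<le> \<mu>"
  shows "a * y \<le> \<mu> * \<bar>y\<bar>"
proof -
  have "a * y \<le> \<bar>a\<bar> * \<bar>y\<bar>" by (metis abs_ge_self abs_mult)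
  also have "\<dots> \<le> \<mu> * \<bar>y\<bar>" using assms by (intro mult_right_mono) auto
  finally show ?thesis .
qed

lemma eq_zero_if_abs_bound_strict:
  fixes a y \<mu> :: real
  assumes "\<bar>a\<bar> < \<mu>" "a * y = \<mu> * \<bar>y\<bar>"
  shows "y = 0"
proof (rule ccontr)
  assume "y \<noteq> 0"
  have "\<mu> * \<bar>y\<bar> \<le> \<bar>a\<bar> * \<bar>y\<bar>" using mult_le_abs_bound[of a "\<bar>a\<bar>" y] assms(2) by simp
  then show False using assms(1) \<open>y \<noteq> 0\<close> by simp
qed

text \<open>The \<open>l\<^sub>1\<close> norm is a sum over the coordinates, so it suffices to test displacements along the axes:
  steps by \<open>1\<close> and \<open>-1\<close> bound \<open>w\<^sub>j\<close>, and the step to \<open>0\<close> gives the equation. The equation encodes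
  \<open>w\<^sub>j = \<mu> sgn x\<^sub>j\<close> if \<open>x\<^sub>j \<noteq> 0\<close> and is void otherwise.\<close>

lemma l1_norm_subgradient_iff:
  fixes w x :: "real ^ 'n"
  assumes "\<mu> \<ge> 0"
  shows "(\<forall>y. w \<bullet> (y - x) \<le> \<mu> * (l1_norm y - l1_norm x)) \<longleftrightarrow>
    (\<forall>j. \<bar>w $ j\<bar> \<le> \<mu> \<and> w $ j * x $ j = \<mu> * \<bar>x $ j\<bar>)"
proof (intro iffI allI)
  fix j assume sub: "\<forall>y. w \<bullet> (y - x) \<le> \<mu> * (l1_norm y - l1_norm x)"
  have coord: "w $ j * s \<le> \<mu> * (\<bar>x $ j + s\<bar> - \<bar>x $ j\<bar>)" for s
  proof -
    have "l1_norm (x + axis j s) - l1_norm x = (\<Sum>i\<in>UNIV. if i = j then \<bar>x $ j + s\<bar> - \<bar>x $ j\<bar> else 0)"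
      unfolding l1_norm_def sum_subtractf[symmetric] by (intro sum.cong) (auto simp: axis_def)
    then have "l1_norm (x + axis j s) - l1_norm x = \<bar>x $ j + s\<bar> - \<bar>x $ j\<bar>" by simp
    then show ?thesis using sub[rule_format, of "x + axis j s"] by (simp add: inner_axis)
  qed
  have step: "\<mu> * (\<bar>x $ j + s\<bar> - \<bar>x $ j\<bar>) \<le> \<mu> * \<bar>s\<bar>" for s
    using assms by (intro mult_left_mono) auto
  have le: "\<bar>w $ j\<bar> \<le> \<mu>"
    using coord[of 1] coord[of "-1"] step[of 1] step[of "-1"] by simp
  then show "\<bar>w $ j\<bar> \<le> \<mu> \<and> w $ j * x $ j = \<mu> * \<bar>x $ j\<bar>"
    using coord[of "- x $ j"] mult_le_abs_bound[OF le, of "x $ j"] by simp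
next
  fix y assume *: "\<forall>j. \<bar>w $ j\<bar> \<le> \<mu> \<and> w $ j * x $ j = \<mu> * \<bar>x $ j\<bar>"
  have "w $ j * (y $ j - x $ j) \<le> \<mu> * (\<bar>y $ j\<bar> - \<bar>x $ j\<bar>)" for j
    using *[rule_format, of j] mult_le_abs_bound[of "w $ j" \<mu> "y $ j"] by (simp add: algebra_simps)
  then have "(\<Sum>j\<in>UNIV. w $ j * (y $ j - x $ j)) \<le> (\<Sum>j\<in>UNIV. \<mu> * (\<bar>y $ j\<bar> - \<bar>x $ j\<bar>))"
    by (rule sum_mono)
  then show "w \<bullet> (y - x) \<le> \<mu> * (l1_norm y - l1_norm x)"
    by (simp add: inner_vec_def l1_norm_def sum_distrib_left[symmetric] sum_subtractf)
qed

text \<open>The sum rule for a differentiable first summand. One inclusion adds the gradient inequality. For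
  the other, go from \<open>x\<close> towards \<open>y\<close>: by convexity the \<open>l\<^sub>1\<close> norm grows at most linearly along the
  segment, and the difference quotient of \<open>f\<close> at \<open>x\<close> tends to the directional derivative.\<close>

lemma subdifferential_F1_sum_rule:
  fixes f :: "real ^ 'n \<Rightarrow> ereal"
  assumes "proper f" "econvex f" "differentiable_at f x" "\<mu> \<ge> 0"
  shows "v \<in> subdifferential (F1 f \<mu>) x \<longleftrightarrow>
    (\<forall>y. (v - gradient f x) \<bullet> (y - x) \<le> \<mu> * (l1_norm y - l1_norm x))"
proof
  let ?r = "\<lambda>y. real_of_ereal (f y)"
  assume v: "v \<in> subdifferential (F1 f \<mu>) x"
  have x: "x \<in> edom f" using assms(3) by (rule differentiable_at_in_edom)
  show "\<forall>y. (v - gradient f x) \<bullet> (y - x) \<le> \<mu> * (l1_norm y - l1_norm x)"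
  proof
    fix y
    let ?d = "y - x"
    have "\<forall>\<^sub>F z in nhds x. z \<in> edom f"
      using assms(3) unfolding differentiable_at_def eventually_nhds
      by (meson interiorE subsetD)
    then have dom: "\<forall>\<^sub>F t in at_right 0. x + t *\<^sub>R ?d \<in> edom f"
      by (rule eventually_along_ray)
    have "(- gradient f x) \<bullet> ?d \<le> \<mu> * (l1_norm y - l1_norm x) - v \<bullet> ?d"
    proof (rule slope_le_if_quotient_le[OF GDERIV_minus[OF gradient_GDERIV[OF assms(3)]]])
      have "\<forall>\<^sub>F t in at_right (0::real). t \<in> {0<..<1}"
        by (rule eventually_at_rightI[of 0 1]) auto
      with dom show "\<forall>\<^sub>F t in at_right 0. - ?r (x + t *\<^sub>R ?d) - - ?r x
          \<le> t * (\<mu> * (l1_norm y - l1_norm x) - v \<bullet> ?d)"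
      proof eventually_elim
        case (elim t)
        have "F1 f \<mu> x + ereal (v \<bullet> (x + t *\<^sub>R ?d - x)) \<le> F1 f \<mu> (x + t *\<^sub>R ?d)"
          using v unfolding subdifferential_def by blast
        then have "?r x + \<mu> * l1_norm x + t * (v \<bullet> ?d) \<le> ?r (x + t *\<^sub>R ?d) + \<mu> * l1_norm (x + t *\<^sub>R ?d)"
          using proper_finite[OF assms(1) x] proper_finite[OF assms(1) elim(1)] unfolding F1_def
          by (cases "f x"; cases "f (x + t *\<^sub>R ?d)") auto
        moreover have "\<mu> * (l1_norm (x + t *\<^sub>R ?d) - l1_norm x) \<le> \<mu> * (t * (l1_norm y - l1_norm x))"
          using l1_norm_segment[of t x ?d] elim(2) assms(4) by (intro mult_left_mono) auto
        ultimately show ?case by (simp add: algebra_simps)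
      qed
    qed
    then show "(v - gradient f x) \<bullet> ?d \<le> \<mu> * (l1_norm y - l1_norm x)"
      by (simp add: inner_diff_left)
  qed
next
  assume *: "\<forall>y. (v - gradient f x) \<bullet> (y - x) \<le> \<mu> * (l1_norm y - l1_norm x)"
  have x: "x \<in> edom f" using assms(3) by (rule differentiable_at_in_edom)
  have "F1 f \<mu> x + ereal (v \<bullet> (y - x)) \<le> F1 f \<mu> y" for y
    using gradient_inequality[OF assms(1-3), of y] *[rule_format, of y] proper_finite[OF assms(1) x]
    unfolding F1_def by (cases "f x"; cases "f y") (auto simp: algebra_simps inner_diff_left)
  moreover have "x \<in> edom (F1 f \<mu>)"
    using x unfolding edom_def F1_def by (cases "f x") auto
  ultimately show "v \<in> subdifferential (F1 f \<mu>) x"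
    unfolding subdifferential_def by blast
qed

lemma subdifferential_F1_iff:
  fixes f :: "real ^ 'n \<Rightarrow> ereal"
  assumes "proper f" "econvex f" "differentiable_at f x" "\<mu> \<ge> 0"
  shows "v \<in> subdifferential (F1 f \<mu>) x \<longleftrightarrow>
    (\<forall>j. \<bar>v $ j - gradient f x $ j\<bar> \<le> \<mu> \<and> (v $ j - gradient f x $ j) * x $ j = \<mu> * \<bar>x $ j\<bar>)"
  using subdifferential_F1_sum_rule[OF assms] l1_norm_subgradient_iff[OF assms(4), of "v - gradient f x" x]
  by simp

section \<open>Strong metric subregularity as an error bound\<close>

text \<open>Near an isolated point \<open>a\<close> of the preimage of \<open>b\<close>, the distance to the preimage is the distance to
  \<open>a\<close>. Conversely, the error bound applied to \<open>y = b\<close> isolates \<open>a\<close>. Bounding \<open>dist b y\<close> for each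
  \<open>y\<close> separately avoids the infimum over a possibly empty set.\<close>

lemma strongly_metrically_subregular_with_iff:
  "strongly_metrically_subregular_with G a b \<kappa> \<longleftrightarrow>
     \<kappa> > 0 \<and> b \<in> G a \<and> (\<forall>\<^sub>F x in nhds a. \<forall>y\<in>G x. dist x a \<le> \<kappa> * dist b y)"
proof
  assume s: "strongly_metrically_subregular_with G a b \<kappa>"
  then have \<kappa>: "\<kappa> > 0" and b: "b \<in> G a"
    unfolding strongly_metrically_subregular_with_def metrically_subregular_with_def by auto
  obtain U where U: "open U" "a \<in> U"
      "\<And>x. x \<in> U \<Longrightarrow> edist_set x (preimage_at G b) \<le> ereal \<kappa> * edist_set b (G x)"
    using s unfolding strongly_metrically_subregular_with_def metrically_subregular_with_def by auto
  obtain e where e: "e > 0" "\<And>z. z \<in> preimage_at G b \<Longrightarrow> dist a z < e \<Longrightarrow> z = a"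
    using s unfolding strongly_metrically_subregular_with_def by (metis isolated_inE_dist)
  have "\<forall>\<^sub>F x in nhds a. x \<in> U" using U(1,2) by (rule eventually_nhds_in_open)
  \<comment> \<open>Half the isolation radius keeps \<open>a\<close> the nearest point of the preimage.\<close>
  moreover have "\<forall>\<^sub>F x in nhds a. dist x a < e / 2"
    using e(1) by (intro eventually_nhds_metric[THEN iffD2]) (auto intro!: exI[of _ "e / 2"])
  ultimately have "\<forall>\<^sub>F x in nhds a. \<forall>y\<in>G x. dist x a \<le> \<kappa> * dist b y"
  proof eventually_elim
    case (elim x)
    have "dist x a \<le> dist x z" if "z \<in> preimage_at G b" for z
    proof (cases "dist a z < e")
      case True
      then show ?thesis using e(2)[OF that] by simp
    next
      case False
      then show ?thesis using elim(2) dist_triangle[of a z x] by (simp add: dist_commute)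
    qed
    then have "ereal (dist x a) \<le> edist_set x (preimage_at G b)"
      unfolding edist_set_def by (intro INF_greatest) simp
    also note U(3)[OF elim(1)]
    finally have le: "ereal (dist x a) \<le> ereal \<kappa> * edist_set b (G x)" .
    show ?case
    proof
      fix y assume "y \<in> G x"
      then have "edist_set b (G x) \<le> ereal (dist b y)"
        unfolding edist_set_def by (rule INF_lower)
      then have "ereal \<kappa> * edist_set b (G x) \<le> ereal \<kappa> * ereal (dist b y)"
        using \<kappa> by (intro ereal_mult_left_mono) auto
      then show "dist x a \<le> \<kappa> * dist b y" using le order_trans by fastforce
    qed
  qed
  then show "\<kappa> > 0 \<and> b \<in> G a \<and> (\<forall>\<^sub>F x in nhds a. \<forall>y\<in>G x. dist x a \<le> \<kappa> * dist b y)"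
    using \<kappa> b by blast
next
  assume "\<kappa> > 0 \<and> b \<in> G a \<and> (\<forall>\<^sub>F x in nhds a. \<forall>y\<in>G x. dist x a \<le> \<kappa> * dist b y)"
  then obtain U where \<kappa>: "\<kappa> > 0" and b: "b \<in> G a" and U: "open U" "a \<in> U"
      "\<And>x y. x \<in> U \<Longrightarrow> y \<in> G x \<Longrightarrow> dist x a \<le> \<kappa> * dist b y"
    unfolding eventually_nhds by blast
  have a: "a \<in> preimage_at G b" using b by (simp add: preimage_at_def)
  have "edist_set x (preimage_at G b) \<le> ereal \<kappa> * edist_set b (G x)" if "x \<in> U" for x
  proof -
    have "ereal (dist x a / \<kappa>) \<le> edist_set b (G x)"
      unfolding edist_set_def using U(3)[OF that] \<kappa>
      by (intro INF_greatest) (simp add: field_simps)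
    then have "ereal \<kappa> * ereal (dist x a / \<kappa>) \<le> ereal \<kappa> * edist_set b (G x)"
      using \<kappa> by (intro ereal_mult_left_mono) auto
    moreover have "edist_set x (preimage_at G b) \<le> ereal (dist x a)"
      unfolding edist_set_def using a by (rule INF_lower)
    ultimately show ?thesis using \<kappa> by simp
  qed
  moreover have "z = a" if "z \<in> U" "z \<in> preimage_at G b" for z
    using U(3)[of z b] that by (simp add: preimage_at_def)
  then have "a isolated_in preimage_at G b"
    unfolding isolated_in_def using U(1,2) a by blast
  ultimately show "strongly_metrically_subregular_with G a b \<kappa>"
    unfolding strongly_metrically_subregular_with_def metrically_subregular_with_def
    using \<kappa> b U(1,2) by blast
qed

section \<open>Quadratic forms on cones and coordinate subspaces\<close>

text \<open>The quotient is invariant under scaling, so its infimum over a closed cone is a minimum over the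
  compact intersection with the unit sphere. For the zero cone the minimum is \<open>\<infinity>\<close>, attained at \<open>0\<close>.\<close>

lemma rayleigh_quotient_attains_Inf:
  fixes A :: "real ^ 'n ^ 'n"
  assumes "closed S" "cone S" "S \<noteq> {}"
  shows "\<exists>u\<in>S. rayleigh_quotient A u = (INF v\<in>S. rayleigh_quotient A v)"
proof -
  have "\<exists>u\<in>S. \<forall>v\<in>S. rayleigh_quotient A u \<le> rayleigh_quotient A v"
  proof (cases "S = {0}")
    case True
    then show ?thesis by simp
  next
    case False
    let ?B = "S \<inter> sphere 0 1"
    have unit: "v /\<^sub>R norm v \<in> ?B" if "v \<in> S" "v \<noteq> 0" for v
      using that assms(2) by (simp add: cone_def)
    then have "?B \<noteq> {}" using False assms(3) by blast
    moreover have "compact ?B" using assms(1) by (intro closed_Int_compact) auto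
    moreover have "continuous_on ?B (\<lambda>v. (A *v v) \<bullet> v)"
      by (intro continuous_intros matrix_vector_mult_linear_continuous_on)
    ultimately obtain u where u: "u \<in> ?B" "\<And>v. v \<in> ?B \<Longrightarrow> (A *v u) \<bullet> u \<le> (A *v v) \<bullet> v"
      using continuous_attains_inf[of ?B "\<lambda>v. (A *v v) \<bullet> v"] by blast
    have "rayleigh_quotient A u \<le> rayleigh_quotient A v" if "v \<in> S" for v
    proof (cases "v = 0")
      case True
      then show ?thesis by (simp add: rayleigh_quotient_def)
    next
      case nz: False
      have "(A *v u) \<bullet> u \<le> (A *v v) \<bullet> v / (norm v)\<^sup>2"
        using u(2)[OF unit[OF that nz]]
        by (simp add: matrix_vector_mult_scaleR power2_eq_square divide_inverse mult_ac)
      then show ?thesis using u(1) nz by (auto simp: rayleigh_quotient_def)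
    qed
    then show ?thesis using u(1) by blast
  qed
  then obtain u where u: "u \<in> S" "\<And>v. v \<in> S \<Longrightarrow> rayleigh_quotient A u \<le> rayleigh_quotient A v"
    by blast
  then have "rayleigh_quotient A u = (INF v\<in>S. rayleigh_quotient A v)"
    by (intro antisym INF_greatest INF_lower)
  then show ?thesis using u(1) by blast
qed


lemma principal_submatrix_mult:
  fixes A :: "real ^ 'n ^ 'n"
  assumes "u \<in> coord_space E"
  shows "(principal_submatrix E A *v u) $ i = (if i \<in> E then (A *v u) $ i else 0)"
proof -
  have "(if i \<in> E \<and> j \<in> E then A $ i $ j else 0) * u $ j = (if i \<in> E then A $ i $ j * u $ j else 0)" for j
    using assms by (auto simp: coord_space_def)
  then show ?thesis
    by (simp add: principal_submatrix_def matrix_vector_mult_def)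
qed

lemma principal_submatrix_quadratic_form:
  fixes A :: "real ^ 'n ^ 'n"
  assumes "u \<in> coord_space E"
  shows "(principal_submatrix E A *v u) \<bullet> u = (A *v u) \<bullet> u"
  unfolding inner_vec_def
  using assms by (intro sum.cong) (auto simp: principal_submatrix_mult coord_space_def)

section \<open>Minimizers of the regularized problem\<close>

text \<open>The local form of the standing assumptions: a minimizer lies in the sublevel set of every interior
  point of the domain, and at the points of this set \<open>f\<close> is continuously differentiable, which entails
  differentiability on a neighbourhood.\<close>

locale l1_minimizer =
  fixes f :: "real ^ 'n \<Rightarrow> ereal" and \<mu> :: real and xs :: "real ^ 'n"
  assumes proper: "proper f" and convex: "econvex f"
    and diff_near: "\<forall>\<^sub>F y in nhds xs. differentiable_at f y"
    and grad_diff: "gradient f differentiable (at xs)"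
    and \<mu>_pos: "\<mu> > 0"
    and minimal: "\<forall>x. F1 f \<mu> xs \<le> F1 f \<mu> x"
begin

abbreviation "g \<equiv> gradient f"
abbreviation "H \<equiv> hessian f xs"
abbreviation "E \<equiv> E_set f \<mu> xs"
abbreviation "U \<equiv> U_set f \<mu> xs"

lemma hessian_derivative: "(g has_derivative (\<lambda>h. H *v h)) (at xs)"
  using grad_diff unfolding hessian_def by (simp add: jacobian_works)

lemma subgradient_iff:
  assumes "differentiable_at f x"
  shows "v \<in> subdifferential (F1 f \<mu>) x \<longleftrightarrow>
    (\<forall>j. \<bar>v $ j - g x $ j\<bar> \<le> \<mu> \<and> (v $ j - g x $ j) * x $ j = \<mu> * \<bar>x $ j\<bar>)"
  using subdifferential_F1_iff[OF proper convex assms] \<mu>_pos by simp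

lemma zero_subgradient: "0 \<in> subdifferential (F1 f \<mu>) xs"
proof -
  have "xs \<in> edom f"
    using eventually_nhds_x_imp_x[OF diff_near] by (rule differentiable_at_in_edom)
  then have "xs \<in> edom (F1 f \<mu>)" unfolding edom_def F1_def by (cases "f xs") auto
  then show ?thesis using minimal unfolding subdifferential_def by (simp flip: zero_ereal_def)
qed

lemma optimality:
  shows "\<bar>g xs $ j\<bar> \<le> \<mu>" "- g xs $ j * xs $ j = \<mu> * \<bar>xs $ j\<bar>"
  using zero_subgradient subgradient_iff[OF eventually_nhds_x_imp_x[OF diff_near], of 0] by auto

lemma inactive_zero:
  assumes "\<bar>g xs $ j\<bar> \<noteq> \<mu>"
  shows "xs $ j = 0"
proof (rule eq_zero_if_abs_bound_strict)
  show "\<bar>- g xs $ j\<bar> < \<mu>" using optimality(1)[of j] assms by simp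
qed (rule optimality)

lemma U_iff:
  "u \<in> U \<longleftrightarrow> (\<forall>j. (\<bar>g xs $ j\<bar> \<noteq> \<mu> \<longrightarrow> u $ j = 0) \<and>
     (\<bar>g xs $ j\<bar> = \<mu> \<longrightarrow> xs $ j = 0 \<longrightarrow> u $ j * g xs $ j \<le> 0))"
  unfolding U_set_def K_set_def E_set_def coord_space_def by auto

lemma zero_mem_U: "0 \<in> U"
  by (simp add: U_iff)

lemma cone_U: "cone U"
  unfolding cone_def
proof (intro ballI allI impI)
  fix u and a :: real
  assume "u \<in> U" "a \<ge> 0"
  then show "a *\<^sub>R u \<in> U" by (simp add: U_iff mult.assoc mult_nonneg_nonpos)
qed

lemma closed_U: "closed U"
proof -
  have "closed {u. (\<bar>g xs $ j\<bar> \<noteq> \<mu> \<longrightarrow> u $ j = 0) \<and>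
     (\<bar>g xs $ j\<bar> = \<mu> \<longrightarrow> xs $ j = 0 \<longrightarrow> u $ j * g xs $ j \<le> 0)}" for j
    by (intro closed_Collect_conj closed_Collect_imp closed_Collect_eq closed_Collect_le
        continuous_intros) auto
  then have "closed (\<Inter>j. {u. (\<bar>g xs $ j\<bar> \<noteq> \<mu> \<longrightarrow> u $ j = 0) \<and>
     (\<bar>g xs $ j\<bar> = \<mu> \<longrightarrow> xs $ j = 0 \<longrightarrow> u $ j * g xs $ j \<le> 0)})"
    by blast
  moreover have "(\<Inter>j. {u. (\<bar>g xs $ j\<bar> \<noteq> \<mu> \<longrightarrow> u $ j = 0) \<and>
     (\<bar>g xs $ j\<bar> = \<mu> \<longrightarrow> xs $ j = 0 \<longrightarrow> u $ j * g xs $ j \<le> 0)}) = U"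
    using U_iff by blast
  ultimately show ?thesis by simp
qed

lemma H_E_mult: "u \<in> U \<Longrightarrow> (H_E f \<mu> xs *v u) $ j = (if j \<in> E then (H *v u) $ j else 0)"
  unfolding H_E_def by (rule principal_submatrix_mult) (simp add: U_set_def)

lemma H_E_quadratic_form: "u \<in> U \<Longrightarrow> (H_E f \<mu> xs *v u) \<bullet> u = (H *v u) \<bullet> u"
  unfolding H_E_def by (rule principal_submatrix_quadratic_form) (simp add: U_set_def)

section \<open>Positivity and nonsingularity\<close>

text \<open>Cyclic monotonicity concerns the full Hessian. Its quadratic form agrees on \<open>\<U>\<close> with that of
  the principal submatrix, and its kernel vectors in \<open>\<U>\<close> are kernel vectors of the submatrix.\<close>

lemma hessian_null_vector:
  assumes "(H *v u) \<bullet> u \<le> 0"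
  shows "H *v u = 0"
  by (rule hessian_kernel[OF _ hessian_cyclic_bound[OF proper convex diff_near hessian_derivative] assms]) simp

lemma positive_iff_nonsingular:
  "(\<forall>u\<in>U - {0}. (H_E f \<mu> xs *v u) \<bullet> u > 0) \<longleftrightarrow> kernel_in E (H_E f \<mu> xs) \<inter> U = {0}"
proof
  assume "\<forall>u\<in>U - {0}. (H_E f \<mu> xs *v u) \<bullet> u > 0"
  then have "u = 0" if "u \<in> U" "H_E f \<mu> xs *v u = 0" for u
    using that by (metis DiffI inner_zero_left less_irrefl singletonD)
  then show "kernel_in E (H_E f \<mu> xs) \<inter> U = {0}"
    using zero_mem_U by (auto simp: kernel_in_def coord_space_def)
next
  assume ker: "kernel_in E (H_E f \<mu> xs) \<inter> U = {0}"
  show "\<forall>u\<in>U - {0}. (H_E f \<mu> xs *v u) \<bullet> u > 0"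
  proof (rule ballI, rule ccontr)
    fix u assume u: "u \<in> U - {0}" and neg: "\<not> (H_E f \<mu> xs *v u) \<bullet> u > 0"
    then have "H *v u = 0"
      by (intro hessian_null_vector) (simp add: H_E_quadratic_form)
    then have "H_E f \<mu> xs *v u = 0" using u by (simp add: vec_eq_iff H_E_mult)
    then have "u \<in> kernel_in E (H_E f \<mu> xs) \<inter> U"
      using u by (simp add: kernel_in_def U_set_def)
    then show False using u ker by auto
  qed
qed

section \<open>The error bound from positivity\<close>

text \<open>If a subgradient \<open>w\<close> of \<open>\<mu>\<parallel>\<cdot>\<parallel>\<^sub>1\<close> at \<open>x\<close> is close to the subgradient \<open>- \<nabla>f\<close> at the minimizer, it
  identifies the active coordinates: off \<open>\<E>\<close> closeness gives \<open>\<bar>w\<^sub>j\<bar> < \<mu>\<close> and hence \<open>x\<^sub>j = 0\<close>, and on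
  \<open>\<E>\<close> a nonzero \<open>x\<^sub>j\<close> has the sign of \<open>w\<^sub>j\<close>, which is opposite to that of \<open>\<nabla>f\<close>.\<close>

lemma displacement_in_U:
  obtains \<delta> where "\<delta> > 0"
    "\<And>x w. (\<And>j. \<bar>w $ j\<bar> \<le> \<mu> \<and> w $ j * x $ j = \<mu> * \<bar>x $ j\<bar>) \<Longrightarrow> norm (w + g xs) < \<delta> \<Longrightarrow> x - xs \<in> U"
proof
  \<comment> \<open>The gaps \<open>\<mu> - \<bar>g xs $ j\<bar>\<close> keep \<open>\<bar>w $ j\<bar> < \<mu>\<close> off \<open>E\<close>; the bound \<open>\<mu>\<close> fixes the sign of \<open>w $ j\<close> on \<open>E\<close>.\<close>
  define \<delta> where "\<delta> = Min (insert \<mu> ((\<lambda>j. \<mu> - \<bar>g xs $ j\<bar>) ` {j. \<bar>g xs $ j\<bar> \<noteq> \<mu>}))"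
  have "0 < \<mu> - \<bar>g xs $ j\<bar>" if "\<bar>g xs $ j\<bar> \<noteq> \<mu>" for j
    using optimality(1)[of j] that by linarith
  then show "\<delta> > 0" unfolding \<delta>_def using \<mu>_pos by (subst Min_gr_iff) auto
  have d1: "\<delta> \<le> \<mu>" unfolding \<delta>_def by simp
  have d2: "\<delta> \<le> \<mu> - \<bar>g xs $ j\<bar>" if "\<bar>g xs $ j\<bar> \<noteq> \<mu>" for j
    unfolding \<delta>_def using that by (intro Min_le) auto
  fix x w :: "real ^ 'n"
  assume w: "\<And>j. \<bar>w $ j\<bar> \<le> \<mu> \<and> w $ j * x $ j = \<mu> * \<bar>x $ j\<bar>" and near: "norm (w + g xs) < \<delta>"
  have wj: "\<bar>w $ j + g xs $ j\<bar> < \<delta>" for j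
    using component_le_norm_cart[of "w + g xs" j] near by simp
  have "x $ j = xs $ j" if j: "\<bar>g xs $ j\<bar> \<noteq> \<mu>" for j
  proof -
    have "\<bar>w $ j\<bar> < \<mu>" using wj[of j] d2[OF j] by linarith
    then show ?thesis
      using eq_zero_if_abs_bound_strict[of "w $ j" \<mu> "x $ j"] w[of j] inactive_zero[OF j] by simp
  qed
  moreover have "x $ j * g xs $ j \<le> 0" if j: "\<bar>g xs $ j\<bar> = \<mu>" for j
  proof (rule ccontr)
    assume neg: "\<not> x $ j * g xs $ j \<le> 0"
    have "w $ j * x $ j \<ge> 0" using w[of j] \<mu>_pos by simp
    then have "w $ j * g xs $ j \<ge> 0" using neg
      by (auto simp: zero_le_mult_iff zero_less_mult_iff not_le)
    then have "\<bar>w $ j + g xs $ j\<bar> \<ge> \<bar>g xs $ j\<bar>"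
      by (auto simp: zero_le_mult_iff)
    then show False using wj[of j] d1 j by linarith
  qed
  ultimately show "x - xs \<in> U" by (simp add: U_iff)
qed

text \<open>Test a subgradient \<open>v\<close> against \<open>h = x - x*\<close>: monotonicity of the \<open>l\<^sub>1\<close> subdifferential removes the
  nonsmooth part, leaving \<open>v \<bullet> h \<ge> Hh \<bullet> h\<close> up to an error \<open>(c - c')\<parallel>h\<parallel>\<^sup>2\<close> that comes from differentiating
  the gradient. The growth hypothesis applies to \<open>h\<close> only if \<open>v\<close> is small; for large \<open>v\<close> the
  claim holds as soon as \<open>h\<close> is small.\<close>

lemma subgradient_lower_bound:
  assumes growth: "\<And>u. u \<in> U \<Longrightarrow> c * (norm u)\<^sup>2 \<le> (H *v u) \<bullet> u" and "c' < c"
  shows "\<forall>\<^sub>F x in nhds xs. \<forall>v\<in>subdifferential (F1 f \<mu>) x. c' * norm (x - xs) \<le> norm v"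
proof -
  obtain \<delta> where \<delta>: "\<delta> > 0"
    "\<And>x w. (\<And>j. \<bar>w $ j\<bar> \<le> \<mu> \<and> w $ j * x $ j = \<mu> * \<bar>x $ j\<bar>) \<Longrightarrow> norm (w + g xs) < \<delta> \<Longrightarrow> x - xs \<in> U"
    using displacement_in_U by blast
  obtain d where "d > 0"
    "\<And>x. norm (x - xs) < d \<Longrightarrow> norm (g x - g xs - H *v (x - xs)) \<le> (c - c') * norm (x - xs)"
    using hessian_derivative \<open>c' < c\<close> unfolding has_derivative_at_alt by (meson diff_gt_0_iff_gt)
  then have lin: "\<forall>\<^sub>F x in nhds xs. norm (g x - g xs - H *v (x - xs)) \<le> (c - c') * norm (x - xs)"
    unfolding eventually_nhds_metric dist_norm by blast
  have "isCont g xs" using hessian_derivative by (rule has_derivative_continuous)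
  then have "((\<lambda>x. g x - g xs) \<longlongrightarrow> 0) (nhds xs)"
    by (simp add: continuous_at LIM_zero tendsto_at_iff_tendsto_nhds)
  from tendstoD[OF this, of "\<delta> / 2"]
  have g_near: "\<forall>\<^sub>F x in nhds xs. norm (g x - g xs) < \<delta> / 2"
    using \<delta>(1) by (simp add: dist_norm)
  have "((\<lambda>x. c' * norm (x - xs)) \<longlongrightarrow> c' * norm (xs - xs)) (nhds xs)"
    by (intro tendsto_intros filterlim_ident)
  then have x_near: "\<forall>\<^sub>F x in nhds xs. c' * norm (x - xs) < \<delta> / 2"
    by (rule order_tendstoD) (use \<delta>(1) in simp)
  from diff_near lin g_near x_near show ?thesis
  proof eventually_elim
    case (elim x)
    show ?case
    proof
      fix v assume "v \<in> subdifferential (F1 f \<mu>) x"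
      then have w: "\<bar>(v - g x) $ j\<bar> \<le> \<mu> \<and> (v - g x) $ j * x $ j = \<mu> * \<bar>x $ j\<bar>" for j
        using subgradient_iff[OF elim(1)] by simp
      let ?h = "x - xs"
      show "c' * norm ?h \<le> norm v"
      proof (cases "norm v < \<delta> / 2")
        case False
        then show ?thesis using elim(4) by linarith
      next
        case True
        have "norm (v - g x + g xs) \<le> norm v + norm (g x - g xs)"
          using norm_triangle_ineq4[of v "g x - g xs"] by (simp add: algebra_simps)
        then have U: "?h \<in> U" using \<delta>(2)[OF w] True elim(3) by simp
        \<comment> \<open>Monotonicity: \<open>v - g x\<close> and \<open>- g xs\<close> are subgradients of the \<open>l\<^sub>1\<close> part at \<open>x\<close> and \<open>xs\<close>.\<close>
        have "0 \<le> (v - g x + g xs) \<bullet> ?h"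
          unfolding inner_vec_def
        proof (rule sum_nonneg)
          fix j
          have "(v - g x) $ j * xs $ j \<le> \<mu> * \<bar>xs $ j\<bar>"
            using w[of j] by (intro mult_le_abs_bound) simp
          moreover have "- g xs $ j * x $ j \<le> \<mu> * \<bar>x $ j\<bar>"
            using optimality(1)[of j] by (intro mult_le_abs_bound) simp
          ultimately show "0 \<le> (v - g x + g xs) $ j \<bullet> ?h $ j"
            using w[of j] optimality(2)[of j] by (simp add: algebra_simps)
        qed
        moreover have "\<bar>(g x - g xs - H *v ?h) \<bullet> ?h\<bar> \<le> (c - c') * norm ?h * norm ?h"
          by (rule order_trans[OF Cauchy_Schwarz_ineq2 mult_right_mono[OF elim(2) norm_ge_zero]])
        moreover note growth[OF U]
        moreover have "v \<bullet> ?h \<le> norm v * norm ?h" by (rule norm_cauchy_schwarz)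
        ultimately have "c' * norm ?h * norm ?h \<le> norm v * norm ?h"
          by (simp add: inner_diff_left inner_add_left power2_eq_square algebra_simps)
        then show ?thesis by (cases "?h = 0") (auto simp: mult_le_cancel_right)
      qed
    qed
  qed
qed

section \<open>Nonsingularity from the error bound\<close>

text \<open>Along \<open>xs + t *\<^sub>R u\<close> the vector \<open>- \<nabla>f xs\<close> remains an admissible \<open>l\<^sub>1\<close> subgradient on the active
  coordinates, because \<open>u \<in> \<U>\<close> moves zero coordinates only in the direction of its sign. The inactive
  coordinates stay \<open>0\<close>, and there the \<open>l\<^sub>1\<close> part can cancel \<open>\<nabla>f\<close>, whose entries still have
  absolute value at most \<open>\<mu>\<close>. The remaining subgradient is \<open>t\<close> times a vector that tends to \<open>H\<^sub>\<E> u = 0\<close>.\<close>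

lemma no_error_bound_along_kernel:
  assumes u: "u \<in> U" and ker: "H_E f \<mu> xs *v u = 0"
    and bound: "\<forall>\<^sub>F x in nhds xs. \<forall>v\<in>subdifferential (F1 f \<mu>) x. norm (x - xs) \<le> \<kappa> * norm v"
  shows "u = 0"
proof -
  define P where "P y = (\<chi> j. if j \<in> E then y $ j else 0)" for y :: "real ^ 'n"
  define q where "q t = (g (xs + t *\<^sub>R u) - g xs) /\<^sub>R t" for t
  have "(q \<longlongrightarrow> H *v u) (at_right 0)"
    unfolding q_def by (rule has_derivative_directional_limit[OF hessian_derivative])
  then have "((\<lambda>t. P (q t)) \<longlongrightarrow> P (H *v u)) (at_right 0)"
    unfolding P_def by (intro tendsto_vec_lambda) (auto intro: tendsto_vec_nth)
  moreover have "P (H *v u) = 0"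
    using ker H_E_mult[OF u] by (auto simp: P_def vec_eq_iff)
  ultimately have lim: "((\<lambda>t. \<kappa> * norm (P (q t))) \<longlongrightarrow> \<kappa> * norm (0 :: real ^ 'n)) (at_right 0)"
    by (intro tendsto_intros) simp
  have "\<forall>\<^sub>F x in nhds xs. \<bar>g x $ j\<bar> \<le> \<mu>" if "j \<notin> E" for j
  proof -
    have "isCont g xs" using hessian_derivative by (rule has_derivative_continuous)
    then have "(g \<longlongrightarrow> g xs) (nhds xs)"
      by (simp add: continuous_at tendsto_at_iff_tendsto_nhds)
    then have "((\<lambda>x. \<bar>g x $ j\<bar>) \<longlongrightarrow> \<bar>g xs $ j\<bar>) (nhds xs)" by (intro tendsto_intros)
    moreover have "\<bar>g xs $ j\<bar> < \<mu>" using optimality(1)[of j] that by (simp add: E_set_def)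
    ultimately have "\<forall>\<^sub>F x in nhds xs. \<bar>g x $ j\<bar> < \<mu>" by (rule order_tendstoD(2))
    then show ?thesis by eventually_elim simp
  qed
  then have "\<forall>\<^sub>F x in nhds xs. \<forall>j. j \<notin> E \<longrightarrow> \<bar>g x $ j\<bar> \<le> \<mu>"
    by (intro eventually_all_finite) (auto intro: eventually_mono)
  from eventually_along_ray[OF this]
  have inactive: "\<forall>\<^sub>F t in at_right 0. \<forall>j. j \<notin> E \<longrightarrow> \<bar>g (xs + t *\<^sub>R u) $ j\<bar> \<le> \<mu>" .
  have "\<forall>\<^sub>F t in at_right 0. xs $ j \<noteq> 0 \<longrightarrow> \<bar>t * u $ j\<bar> < \<bar>xs $ j\<bar>" for j
  proof (cases "xs $ j = 0")
    case False
    have "((\<lambda>t. \<bar>t * u $ j\<bar>) \<longlongrightarrow> \<bar>0 * u $ j\<bar>) (at_right 0)" by (intro tendsto_intros)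
    then have "\<forall>\<^sub>F t in at_right 0. \<bar>t * u $ j\<bar> < \<bar>xs $ j\<bar>"
      by (rule order_tendstoD) (use False in simp)
    then show ?thesis by eventually_elim simp
  qed simp
  then have sign: "\<forall>\<^sub>F t in at_right 0. \<forall>j. xs $ j \<noteq> 0 \<longrightarrow> \<bar>t * u $ j\<bar> < \<bar>xs $ j\<bar>"
    by (rule eventually_all_finite)
  have "\<forall>\<^sub>F t in at_right 0. norm u \<le> \<kappa> * norm (P (q t))"
    using eventually_along_ray[OF diff_near, of u] eventually_along_ray[OF bound, of u]
      inactive sign eventually_at_right_less[of "0::real"]
  proof eventually_elim
    case (elim t)
    let ?x = "xs + t *\<^sub>R u"
    let ?v = "t *\<^sub>R P (q t)"
    have v: "?v $ j - g ?x $ j = (if j \<in> E then - g xs $ j else - g ?x $ j)" for j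
      using elim(5) by (simp add: P_def q_def field_simps)
    have "\<bar>?v $ j - g ?x $ j\<bar> \<le> \<mu> \<and> (?v $ j - g ?x $ j) * ?x $ j = \<mu> * \<bar>?x $ j\<bar>" for j
    proof (cases "j \<in> E")
      case True
      then have gj: "\<bar>g xs $ j\<bar> = \<mu>" by (simp add: E_set_def)
      have "- g xs $ j * ?x $ j = \<mu> * \<bar>?x $ j\<bar>"
      proof (cases "xs $ j = 0")
        case z: True
        then have "u $ j * g xs $ j \<le> 0" using u gj by (simp add: U_iff)
        then have "- g xs $ j * u $ j = \<mu> * \<bar>u $ j\<bar>"
          using gj by (metis abs_mult abs_of_nonpos mult.commute mult_minus_left)
        then have "t * (- g xs $ j * u $ j) = t * (\<mu> * \<bar>u $ j\<bar>)" by simp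
        then show ?thesis using z elim(5) by (simp add: abs_mult mult_ac)
      next
        case nz: False
        then have small: "\<bar>t * u $ j\<bar> < \<bar>xs $ j\<bar>" using elim(4) by blast
        have "- g xs $ j * xs $ j = \<mu> * sgn (xs $ j) * xs $ j"
          using optimality(2)[of j] by (simp add: abs_sgn mult_ac)
        then have "- g xs $ j = \<mu> * sgn (xs $ j)" using nz mult_right_cancel by blast
        moreover have "sgn (?x $ j) = sgn (xs $ j)"
          using small by (auto simp: sgn_if)
        ultimately show ?thesis by (simp add: abs_sgn)
      qed
      then show ?thesis unfolding v using True gj by simp
    next
      case False
      then have "?x $ j = 0"
        using u inactive_zero[of j] by (simp add: U_iff E_set_def)
      then show ?thesis unfolding v using False elim(3) by simp
    qed
    then have "?v \<in> subdifferential (F1 f \<mu>) ?x"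
      using subgradient_iff[OF elim(1)] by blast
    then have "norm (?x - xs) \<le> \<kappa> * norm ?v" using elim(2) by blast
    then have "t * norm u \<le> t * (\<kappa> * norm (P (q t)))" using elim(5) by (simp add: mult_ac)
    then show ?case using elim(5) by simp
  qed
  then have "norm u \<le> \<kappa> * norm (0 :: real ^ 'n)"
    by (intro tendsto_lowerbound[OF lim]) auto
  then show ?thesis by simp
qed

lemma nonsingular_if_subregular:
  assumes "strongly_metrically_subregular (subdifferential (F1 f \<mu>)) xs 0"
  shows "kernel_in E (H_E f \<mu> xs) \<inter> U = {0}"
proof -
  obtain \<kappa> where "strongly_metrically_subregular_with (subdifferential (F1 f \<mu>)) xs 0 \<kappa>"
    using assms unfolding strongly_metrically_subregular_def by blast
  then have "\<forall>\<^sub>F x in nhds xs. \<forall>v\<in>subdifferential (F1 f \<mu>) x. norm (x - xs) \<le> \<kappa> * norm v"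
    unfolding strongly_metrically_subregular_with_iff by (simp add: dist_norm)
  then show ?thesis
    using no_error_bound_along_kernel zero_mem_U by (auto simp: kernel_in_def coord_space_def)
qed

section \<open>The modulus\<close>

lemma c_const_attained: "\<exists>u\<in>U. rayleigh_quotient (H_E f \<mu> xs) u = c_const f \<mu> xs"
  unfolding c_const_def using rayleigh_quotient_attains_Inf closed_U cone_U zero_mem_U by blast

lemma c_const_pos:
  assumes "\<forall>u\<in>U - {0}. (H_E f \<mu> xs *v u) \<bullet> u > 0"
  shows "c_const f \<mu> xs > 0"
proof -
  obtain u where "u \<in> U" and "rayleigh_quotient (H_E f \<mu> xs) u = c_const f \<mu> xs"
    using c_const_attained by blast
  moreover have "rayleigh_quotient (H_E f \<mu> xs) u > 0"
    using assms \<open>u \<in> U\<close> by (simp add: rayleigh_quotient_def)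
  ultimately show ?thesis by simp
qed

lemma quadratic_growth_below_c_const:
  assumes "ereal c \<le> c_const f \<mu> xs" "u \<in> U"
  shows "c * (norm u)\<^sup>2 \<le> (H *v u) \<bullet> u"
proof (cases "u = 0")
  case False
  have "ereal c \<le> rayleigh_quotient (H_E f \<mu> xs) u"
    using assms INF_lower[OF assms(2)] unfolding c_const_def by (meson order_trans)
  then show ?thesis
    using False by (simp add: rayleigh_quotient_def H_E_quadratic_form[OF assms(2)] field_simps)
qed simp

text \<open>A real \<open>c\<close> between \<open>1 / \<kappa>\<close> and the minimum leaves room for the strict inequality in
  \<open>subgradient_lower_bound\<close>, and also covers an infinite minimum, where \<open>\<U> = {0}\<close>.\<close>

lemma subregular_with_modulus:
  assumes "c_const f \<mu> xs > 0" "ereal \<kappa> > inverse (c_const f \<mu> xs)"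
  shows "strongly_metrically_subregular_with (subdifferential (F1 f \<mu>)) xs 0 \<kappa>"
proof -
  have "0 \<le> inverse (c_const f \<mu> xs)" using assms(1) by (simp add: ereal_inverse_nonneg_iff)
  then have \<kappa>: "\<kappa> > 0" using assms(2) le_less_trans by fastforce
  have "ereal (1 / \<kappa>) < c_const f \<mu> xs"
    using assms \<kappa> by (cases "c_const f \<mu> xs") (auto simp: field_simps)
  then obtain c where c: "1 / \<kappa> < c" "ereal c \<le> c_const f \<mu> xs"
    using ereal_dense2[of "ereal (1 / \<kappa>)" "c_const f \<mu> xs"] by auto
  have "\<forall>\<^sub>F x in nhds xs. \<forall>v\<in>subdifferential (F1 f \<mu>) x. 1 / \<kappa> * norm (x - xs) \<le> norm v"
    using subgradient_lower_bound[OF quadratic_growth_below_c_const[OF c(2)] c(1)] .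
  then have "\<forall>\<^sub>F x in nhds xs. \<forall>v\<in>subdifferential (F1 f \<mu>) x. dist x xs \<le> \<kappa> * dist 0 v"
    by eventually_elim (use \<kappa> in \<open>auto simp: dist_norm field_simps\<close>)
  then show ?thesis
    unfolding strongly_metrically_subregular_with_iff using \<kappa> zero_subgradient by blast
qed

lemma subregular_if_positive:
  assumes "\<forall>u\<in>U - {0}. (H_E f \<mu> xs *v u) \<bullet> u > 0"
  shows "strongly_metrically_subregular (subdifferential (F1 f \<mu>)) xs 0"
proof -
  have "inverse (c_const f \<mu> xs) \<noteq> \<infinity>"
    using c_const_pos[OF assms] by (cases "c_const f \<mu> xs") auto
  then obtain \<kappa> where "inverse (c_const f \<mu> xs) < ereal \<kappa>"
    using ereal_dense2[of "inverse (c_const f \<mu> xs)" \<infinity>] by auto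
  then show ?thesis
    using subregular_with_modulus[OF c_const_pos[OF assms]]
    unfolding strongly_metrically_subregular_def by blast
qed

end

section \<open>The characterization\<close>

theorem theorem5p7:
  fixes f :: "real ^ 'n \<Rightarrow> ereal" and \<mu> :: real and xstar :: "real ^ 'n"
  assumes "proper f" and "lower_semicontinuous f" and "econvex f"
    and "interior (edom f) \<noteq> {}"
    and "\<And>x. x \<in> interior (edom f) \<Longrightarrow> {y. F1 f \<mu> y \<le> F1 f \<mu> x} \<subseteq> interior (edom f)"
    and "\<And>x y. x \<in> interior (edom f) \<Longrightarrow> y \<in> {y. F1 f \<mu> y \<le> F1 f \<mu> x} \<Longrightarrow>
           continuously_differentiable_at f y"
    and "\<mu> > 0"
    and "\<forall>x. F1 f \<mu> xstar \<le> F1 f \<mu> x"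
    and "gradient f differentiable (at xstar)"
  shows
    "(strongly_metrically_subregular (subdifferential (F1 f \<mu>)) xstar 0 \<longleftrightarrow>
        (\<forall>u \<in> U_set f \<mu> xstar - {0}. (H_E f \<mu> xstar *v u) \<bullet> u > 0)) \<and>
     ((\<forall>u \<in> U_set f \<mu> xstar - {0}. (H_E f \<mu> xstar *v u) \<bullet> u > 0) \<longleftrightarrow>
        kernel_in (E_set f \<mu> xstar) (H_E f \<mu> xstar) \<inter> U_set f \<mu> xstar = {0}) \<and>
     ((\<forall>u \<in> U_set f \<mu> xstar - {0}. (H_E f \<mu> xstar *v u) \<bullet> u > 0) \<longrightarrow>
        (\<exists>u \<in> U_set f \<mu> xstar. rayleigh_quotient (H_E f \<mu> xstar) u = c_const f \<mu> xstar) \<and>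
        (\<forall>\<kappa>::real. ereal \<kappa> > inverse (c_const f \<mu> xstar) \<longrightarrow>
           strongly_metrically_subregular_with (subdifferential (F1 f \<mu>)) xstar 0 \<kappa>))"
proof -
  \<comment> \<open>A minimizer lies in the sublevel set of every interior point.\<close>
  obtain x0 where "x0 \<in> interior (edom f)" using assms(4) by blast
  then have "continuously_differentiable_at f xstar" using assms(6,8) by blast
  then interpret l1_minimizer f \<mu> xstar
    using assms unfolding continuously_differentiable_at_def by unfold_locales auto
  show ?thesis
    using positive_iff_nonsingular nonsingular_if_subregular subregular_if_positive
      c_const_attained subregular_with_modulus c_const_pos by blast
qed

end
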